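(* The Gaussian and mean curvatures of an admissible parabolic revolution surface of i-type in $\mathbb{I}^3$, $$Z_3(u,t)=\left(at+x(u),\ bt,\ ct+\tfrac{ac_1+bc_2}{2}t^2+c_1t\,x(u)+z(u)\right),$$ with $C^2$ generating curve $\alpha(u)=(x(u),0,z(u))$, are respectively $$K=-\frac{(ac_1+bc_2)(x''z'-x'z'')}{b^2x'^3}-\frac{c_1^2}{b^2},\qquad H=\frac{bc_2-ac_1}{2b^2}-\frac{a^2+b^2}{2b^2}\,\frac{x''z'-x'z''}{x'^3}.$$
   Context: Here $a,b,c,c_1,c_2\in\mathbb{R}$ are constants with $ac_1+bc_2\neq0$ (the defining condition of parabolic rotations), and primes denote $d/du$. The simply isotropic space $\mathbb{I}^3$ is $\mathbb{R}^3$ with the degenerate metric $\langle u,v\rangle_z=u^1v^1+u^2v^2$. For a $C^2$ parameterized surface $\mathbf{x}(u^1,u^2)=(x^1,x^2,x^3)$ write $\mathbf{x}_i=\partial\mathbf{x}/\partial u^i$, $\mathbf{x}_{ij}=\partial^2\mathbf{x}/\partial u^i\partial u^j$, $x^i_k=\partial x^i/\partial u^k$, $X_{ij}=x^i_1x^j_2-x^j_1x^i_2$. The surface is admissible if $X_{12}\neq0$ (equivalently, the induced metric has rank 2). Put $g_{ij}=\langle\mathbf{x}_i,\mathbf{x}_j\rangle_z$, $N_h=\left(\frac{X_{23}}{X_{12}},\frac{X_{31}}{X_{12}},1\right)$, $h_{ij}=\langle N_h,\mathbf{x}_{ij}\rangle$ (Euclidean inner product). The Gaussian and mean curvatures are $$K=\frac{h_{11}h_{22}-h_{12}^2}{g_{11}g_{22}-g_{12}^2},\qquad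 H=\frac12\,\frac{g_{11}h_{22}-2g_{12}h_{12}+g_{22}h_{11}}{g_{11}g_{22}-g_{12}^2};$$ equivalently $K=\det L$, $H=\frac12\mathrm{tr}\,L$ with $L=-D\xi$, $\xi=\left(A,B,\frac12(1-A^2-B^2)\right)$, $A=X_{23}/X_{12}$, $B=X_{31}/X_{12}$. For the surface in the claim the coordinates are $(u^1,u^2)=(u,t)$. *)

theory Defs
  imports "HOL-Analysis.Analysis"
begin

text \<open>Two-sided derivatives are used, so \<open>I\<close> is meant to be open.\<close>

definition C2_on :: "real set \<Rightarrow> (real \<Rightarrow> 'a::real_normed_vector) \<Rightarrow> bool" where
  "C2_on I f \<longleftrightarrow>
     (\<exists>f' f''. (\<forall>u\<in>I. (f has_vector_derivative f' u) (at u)) \<and>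
              (\<forall>u\<in>I. (f' has_vector_derivative f'' u) (at u)) \<and>
              continuous_on I f'')"

definition iso_inner :: "real^3 \<Rightarrow> real^3 \<Rightarrow> real" where
  "iso_inner v w = v $ 1 * w $ 1 + v $ 2 * w $ 2"

definition partial :: "2 \<Rightarrow> (real^2 \<Rightarrow> 'a::real_normed_vector) \<Rightarrow> real^2 \<Rightarrow> 'a" where
  "partial i X p = vector_derivative (\<lambda>s. X (p + s *\<^sub>R axis i 1)) (at 0)"

text \<open>The minor \<open>X\<^sub>i\<^sub>j = x\<^sup>i\<^sub>1 x\<^sup>j\<^sub>2 - x\<^sup>j\<^sub>1 x\<^sup>i\<^sub>2\<close> of the Jacobian matrix of a surface.\<close>

definition minor :: "(real^2 \<Rightarrow> real^3) \<Rightarrow> 3 \<Rightarrow> 3 \<Rightarrow> real^2 \<Rightarrow> real" where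
  "minor X i j p =
     partial 1 X p $ i * partial 2 X p $ j - partial 1 X p $ j * partial 2 X p $ i"

definition admissible_on :: "(real^2) set \<Rightarrow> (real^2 \<Rightarrow> real^3) \<Rightarrow> bool" where
  "admissible_on U X \<longleftrightarrow> (\<forall>p\<in>U. minor X 1 2 p \<noteq> 0)"

definition first_form :: "(real^2 \<Rightarrow> real^3) \<Rightarrow> 2 \<Rightarrow> 2 \<Rightarrow> real^2 \<Rightarrow> real" where
  "first_form X i j p = iso_inner (partial i X p) (partial j X p)"

definition iso_normal :: "(real^2 \<Rightarrow> real^3) \<Rightarrow> real^2 \<Rightarrow> real^3" where
  "iso_normal X p = vector [minor X 2 3 p / minor X 1 2 p, minor X 3 1 p / minor X 1 2 p, 1]"

definition second_form :: "(real^2 \<Rightarrow> real^3) \<Rightarrow> 2 \<Rightarrow> 2 \<Rightarrow> real^2 \<Rightarrow> real" where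
  "second_form X i j p = iso_normal X p \<bullet> partial i (partial j X) p"

definition gauss_curvature :: "(real^2 \<Rightarrow> real^3) \<Rightarrow> real^2 \<Rightarrow> real" where
  "gauss_curvature X p =
     (second_form X 1 1 p * second_form X 2 2 p - (second_form X 1 2 p)\<^sup>2) /
     (first_form X 1 1 p * first_form X 2 2 p - (first_form X 1 2 p)\<^sup>2)"

definition mean_curvature :: "(real^2 \<Rightarrow> real^3) \<Rightarrow> real^2 \<Rightarrow> real" where
  "mean_curvature X p =
     1 / 2 *
     ((first_form X 1 1 p * second_form X 2 2 p - 2 * first_form X 1 2 p * second_form X 1 2 p
        + first_form X 2 2 p * second_form X 1 1 p) /
      (first_form X 1 1 p * first_form X 2 2 p - (first_form X 1 2 p)\<^sup>2))"

text \<open>The orbit of the curve \<open>(x u, 0, z u)\<close> under a one-parameter group of parabolic rotations with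
  parameter \<open>t\<close>.\<close>

definition Z3 ::
  "real \<Rightarrow> real \<Rightarrow> real \<Rightarrow> real \<Rightarrow> real \<Rightarrow> (real \<Rightarrow> real) \<Rightarrow> (real \<Rightarrow> real) \<Rightarrow> real^2 \<Rightarrow> real^3"
where
  "Z3 a b c c1 c2 x z p =
     (let u = p $ 1; t = p $ 2 in
      vector [a * t + x u,
              b * t,
              c * t + (a * c1 + b * c2) / 2 * t\<^sup>2 + c1 * t * x u + z u])"

end

theory Submission
  imports Defs
begin

text \<open>
  In the coordinates \<open>(u, t)\<close> the \<open>t\<close>-dependence of the surface is polynomial of degree two, so
  everything is explicit. Write \<open>k = a c\<^sub>1 + b c\<^sub>2\<close>. The tangent vectors are
  \<open>(x', 0, c\<^sub>1 t x' + z')\<close> and \<open>(a, b, c + k t + c\<^sub>1 x)\<close>, hence \<open>X\<^sub>1\<^sub>2 = b x'\<close> and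
  \<open>g\<^sub>1\<^sub>1 g\<^sub>2\<^sub>2 - g\<^sub>1\<^sub>2\<^sup>2 = (b x')\<^sup>2\<close>. The second derivatives in the directions \<open>(1, 2)\<close> and \<open>(2, 2)\<close>
  are vertical, and the third component of \<open>N\<^sub>h\<close> is 1, so \<open>h\<^sub>1\<^sub>2 = c\<^sub>1 x'\<close> and \<open>h\<^sub>2\<^sub>2 = k\<close>. In \<open>h\<^sub>1\<^sub>1\<close>
  the contributions of \<open>c\<^sub>1 t x''\<close> cancel, which leaves \<open>h\<^sub>1\<^sub>1 = (x' z'' - x'' z') / x'\<close>. No
  coefficient depends on \<open>t\<close>, as has to be for the orbit of a curve under a group of isometries of
  the simply isotropic space, and the two formulas are the resulting quotients.

  The analytic content is small: the profile curve is given as a \<open>C\<^sup>2\<close> map into space, from which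
  \<open>x\<close> and \<open>z\<close> inherit their derivatives (\<open>C2_on_component\<close>, \<open>C2_on_DERIV\<close>), and a second partial
  derivative needs the first one on a whole parameter line segment, which is where openness of
  \<open>I\<close> enters.
\<close>

lemma C2_on_component:
  assumes "C2_on I (f :: real \<Rightarrow> real^'n)"
  shows "C2_on I (\<lambda>u. f u $ i)"
proof -
  from assms obtain f' f'' where
    "\<forall>u\<in>I. (f has_vector_derivative f' u) (at u)"
    "\<forall>u\<in>I. (f' has_vector_derivative f'' u) (at u)" "continuous_on I f''"
    unfolding C2_on_def by blast
  then show ?thesis
    unfolding C2_on_def
    by (intro exI[of _ "\<lambda>u. f' u $ i"] exI[of _ "\<lambda>u. f'' u $ i"])
       (auto intro!: continuous_intros
          bounded_linear.has_vector_derivative[OF bounded_linear_vec_nth])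
qed

text \<open>The derivatives witnessing \<open>C2_on\<close> agree with \<open>deriv\<close> only on \<open>I\<close>; openness makes this
  agreement local at each point, so that it passes to the second derivative.\<close>

lemma C2_on_DERIV:
  fixes f :: "real \<Rightarrow> real"
  assumes "open I" "C2_on I f" "u \<in> I"
  shows "(f has_vector_derivative deriv f u) (at u)"
    and "(deriv f has_vector_derivative deriv (deriv f) u) (at u)"
proof -
  from assms(2) obtain f' f'' where
    f': "\<And>u. u \<in> I \<Longrightarrow> (f has_real_derivative f' u) (at u)" and
    f'': "\<And>u. u \<in> I \<Longrightarrow> (f' has_real_derivative f'' u) (at u)"
    unfolding C2_on_def has_real_derivative_iff_has_vector_derivative by blast
  have eq: "deriv f v = f' v" if "v \<in> I" for v
    using f'[OF that] by (rule DERIV_imp_deriv)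
  show "(f has_vector_derivative deriv f u) (at u)"
    using f' eq assms(3) by (simp add: has_real_derivative_iff_has_vector_derivative)
  have "(deriv f has_real_derivative f'' u) (at u)"
    by (rule has_field_derivative_transform_within_open[OF f''[OF assms(3)] assms(1,3)])
       (simp add: eq)
  then show "(deriv f has_vector_derivative deriv (deriv f) u) (at u)"
    by (simp add: has_real_derivative_iff_has_vector_derivative[symmetric] DERIV_imp_deriv)
qed

lemma has_vector_derivative_vector_3:
  fixes f g h :: "real \<Rightarrow> real"
  assumes "(f has_vector_derivative f') F" "(g has_vector_derivative g') F"
    "(h has_vector_derivative h') F"
  shows "((\<lambda>s. vector [f s, g s, h s] :: real^3) has_vector_derivative vector [f', g', h']) F"
proof -
  have split: "vector [p, q, r] = p *\<^sub>R axis 1 1 + q *\<^sub>R axis 2 1 + r *\<^sub>R (axis 3 1 :: real^3)"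
    for p q r :: real
    by (simp add: vec_eq_iff forall_3 axis_def)
  have scale: "((\<lambda>s. k s *\<^sub>R e) has_vector_derivative k' *\<^sub>R e) F"
    if "(k has_vector_derivative k') F" for k k' and e :: "real^3"
    by (rule bounded_linear.has_vector_derivative[OF bounded_linear_scaleR_left that])
  show ?thesis
    unfolding split by (intro has_vector_derivative_add scale assms)
qed

lemma has_vector_derivative_translate:
  fixes f :: "real \<Rightarrow> 'a::real_normed_vector"
  assumes "(f has_vector_derivative d) (at u)"
  shows "((\<lambda>s. f (u + s)) has_vector_derivative d) (at 0)"
proof -
  have "((\<lambda>s. u + s) has_vector_derivative 1) (at 0)"
    by (auto intro!: derivative_eq_intros)
  from vector_diff_chain_at[OF this, of f d] assms show ?thesis
    by (simp add: o_def)
qed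

text \<open>Moving along a coordinate line changes a single coordinate, so partial derivatives are
  derivatives of one-variable functions in the coordinate itself.\<close>

lemma partial_1_eqI:
  assumes "((\<lambda>v. X (vector [v, t])) has_vector_derivative d) (at u)"
  shows "partial 1 X (vector [u, t]) = d"
proof -
  have line: "vector [u, t] + s *\<^sub>R axis 1 1 = (vector [u + s, t] :: real^2)" for s
    by (simp add: vec_eq_iff forall_2 axis_def)
  have "((\<lambda>s. X (vector [u + s, t])) has_vector_derivative d) (at 0)"
    using assms by (rule has_vector_derivative_translate)
  then show ?thesis
    unfolding partial_def line by (rule vector_derivative_at)
qed

lemma partial_2_eqI:
  assumes "((\<lambda>v. X (vector [u, v])) has_vector_derivative d) (at t)"
  shows "partial 2 X (vector [u, t]) = d"
proof -
  have line: "vector [u, t] + s *\<^sub>R axis 2 1 = (vector [u, t + s] :: real^2)" for s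
    by (simp add: vec_eq_iff forall_2 axis_def)
  have "((\<lambda>s. X (vector [u, t + s])) has_vector_derivative d) (at 0)"
    using assms by (rule has_vector_derivative_translate)
  then show ?thesis
    unfolding partial_def line by (rule vector_derivative_at)
qed

lemma Z3_vector:
  "Z3 a b c c1 c2 x z (vector [u, t]) =
     vector [a * t + x u, b * t,
             c * t + (a * c1 + b * c2) / 2 * t\<^sup>2 + c1 * t * x u + z u]"
  by (simp add: Z3_def)

section \<open>Partial derivatives of the surface\<close>

lemma partial_1_Z3:
  assumes "(x has_vector_derivative x') (at u)" "(z has_vector_derivative z') (at u)"
  shows "partial 1 (Z3 a b c c1 c2 x z) (vector [u, t]) = vector [x', 0, c1 * t * x' + z']"
  by (rule partial_1_eqI, unfold Z3_vector, rule has_vector_derivative_vector_3)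
     (use assms in \<open>auto simp: has_real_derivative_iff_has_vector_derivative[symmetric]
        intro!: derivative_eq_intros\<close>)

lemma partial_2_Z3:
  "partial 2 (Z3 a b c c1 c2 x z) (vector [u, t]) =
     vector [a, b, c + (a * c1 + b * c2) * t + c1 * x u]"
  by (rule partial_2_eqI, unfold Z3_vector, rule has_vector_derivative_vector_3)
     (auto simp: has_real_derivative_iff_has_vector_derivative[symmetric]
        intro!: derivative_eq_intros)

lemma partial_1_partial_1_Z3:
  assumes "open I" "C2_on I x" "C2_on I z" "u \<in> I"
  shows "partial 1 (partial 1 (Z3 a b c c1 c2 x z)) (vector [u, t]) =
           vector [deriv (deriv x) u, 0, c1 * t * deriv (deriv x) u + deriv (deriv z) u]"
proof (rule partial_1_eqI, rule has_vector_derivative_transform_within_open[OF _ assms(1,4)])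
  show "((\<lambda>v. vector [deriv x v, 0, c1 * t * deriv x v + deriv z v] :: real^3)
          has_vector_derivative
        vector [deriv (deriv x) u, 0, c1 * t * deriv (deriv x) u + deriv (deriv z) u]) (at u)"
    by (rule has_vector_derivative_vector_3)
       (use C2_on_DERIV[OF assms(1,2,4)] C2_on_DERIV[OF assms(1,3,4)] in
        \<open>auto simp: has_real_derivative_iff_has_vector_derivative[symmetric]
          intro!: derivative_eq_intros\<close>)
  show "vector [deriv x v, 0, c1 * t * deriv x v + deriv z v] =
          partial 1 (Z3 a b c c1 c2 x z) (vector [v, t])" if "v \<in> I" for v
    by (rule partial_1_Z3[symmetric]) (use assms that in \<open>auto intro: C2_on_DERIV\<close>)
qed

lemma partial_1_partial_2_Z3:
  assumes "(x has_vector_derivative x') (at u)"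
  shows "partial 1 (partial 2 (Z3 a b c c1 c2 x z)) (vector [u, t]) = vector [0, 0, c1 * x']"
  by (rule partial_1_eqI, unfold partial_2_Z3, rule has_vector_derivative_vector_3)
     (use assms in \<open>auto simp: has_real_derivative_iff_has_vector_derivative[symmetric]
        intro!: derivative_eq_intros\<close>)

lemma partial_2_partial_2_Z3:
  "partial 2 (partial 2 (Z3 a b c c1 c2 x z)) (vector [u, t]) = vector [0, 0, a * c1 + b * c2]"
  by (rule partial_2_eqI, unfold partial_2_Z3, rule has_vector_derivative_vector_3)
     (auto simp: has_real_derivative_iff_has_vector_derivative[symmetric]
        intro!: derivative_eq_intros)

section \<open>Curvatures\<close>

theorem proposition5p4:
  fixes a b c c1 c2 :: real
    and I :: "real set"
    and x z :: "real \<Rightarrow> real"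
  assumes parabolic: "a * c1 + b * c2 \<noteq> 0"
    and I: "open I" "is_interval I"
    and C2: "C2_on I (\<lambda>u. vector [x u, 0, z u] :: real^3)"
    and admissible: "admissible_on {p. p $ 1 \<in> I} (Z3 a b c c1 c2 x z)"
  shows "\<forall>u\<in>I. \<forall>t::real.
    gauss_curvature (Z3 a b c c1 c2 x z) (vector [u, t]) =
      - ((a * c1 + b * c2) *
          (deriv (deriv x) u * deriv z u - deriv x u * deriv (deriv z) u)) /
        (b\<^sup>2 * (deriv x u)^3)
      - c1\<^sup>2 / b\<^sup>2
    \<and>
    mean_curvature (Z3 a b c c1 c2 x z) (vector [u, t]) =
      (b * c2 - a * c1) / (2 * b\<^sup>2)
      - (a\<^sup>2 + b\<^sup>2) / (2 * b\<^sup>2) *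
        ((deriv (deriv x) u * deriv z u - deriv x u * deriv (deriv z) u) / (deriv x u)^3)"
proof (intro ballI allI)
  fix u t :: real
  assume u: "u \<in> I"
  let ?Z = "Z3 a b c c1 c2 x z" and ?p = "vector [u, t] :: real^2"
  define x' z' x'' z'' k where
    "x' = deriv x u" and "z' = deriv z u" and "x'' = deriv (deriv x) u"
    and "z'' = deriv (deriv z) u" and "k = a * c1 + b * c2"
  note names = x'_def[symmetric] z'_def[symmetric] x''_def[symmetric] z''_def[symmetric]
    k_def[symmetric]

  have C2x: "C2_on I x" and C2z: "C2_on I z"
    using C2_on_component[OF C2, of 1] C2_on_component[OF C2, of 3] by simp_all
  note Dx = C2_on_DERIV(1)[OF I(1) C2x u] and Dz = C2_on_DERIV(1)[OF I(1) C2z u]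
  note partials = partial_1_Z3[OF Dx Dz, unfolded names] partial_2_Z3
  note partials2 = partial_1_partial_1_Z3[OF I(1) C2x C2z u, unfolded names]
    partial_1_partial_2_Z3[OF Dx, unfolded names] partial_2_partial_2_Z3

  have X12: "minor ?Z 1 2 ?p = x' * b"
    by (simp add: minor_def partials)
  moreover have "minor ?Z 1 2 ?p \<noteq> 0"
    using admissible u by (auto simp: admissible_on_def)
  ultimately have nz: "x' \<noteq> 0" "b \<noteq> 0" by auto

  have g: "first_form ?Z 1 1 ?p = x'\<^sup>2" "first_form ?Z 1 2 ?p = a * x'"
    "first_form ?Z 2 2 ?p = a\<^sup>2 + b\<^sup>2"
    by (simp_all add: first_form_def iso_inner_def partials power2_eq_square)
  have det: "x'\<^sup>2 * (a\<^sup>2 + b\<^sup>2) - (a * x')\<^sup>2 = b\<^sup>2 * x'\<^sup>2"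
    by (simp add: algebra_simps power2_eq_square)

  have X23: "minor ?Z 2 3 ?p = - (b * (c1 * t * x' + z'))"
    by (simp add: minor_def partials)
  have h12: "second_form ?Z 1 2 ?p = c1 * x'" and h22: "second_form ?Z 2 2 ?p = k"
    by (simp_all add: second_form_def iso_normal_def inner_vec_def sum_3 partials2 k_def)
  have "second_form ?Z 1 1 ?p = minor ?Z 2 3 ?p / minor ?Z 1 2 ?p * x'' + (c1 * t * x'' + z'')"
    by (simp add: second_form_def iso_normal_def inner_vec_def sum_3 partials2)
  also have "\<dots> = - (x'' * z' - x' * z'') / x'"
    using nz by (simp add: X12 X23 field_simps)
  finally have h11: "second_form ?Z 1 1 ?p = - (x'' * z' - x' * z'') / x'" .

  have "gauss_curvature ?Z ?p = (- (x'' * z' - x' * z'') / x' * k - (c1 * x')\<^sup>2) / (b\<^sup>2 * x'\<^sup>2)"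
    by (simp only: gauss_curvature_def g h11 h12 h22 det mult.commute)
  also have "\<dots> = - (k * (x'' * z' - x' * z'')) / (b\<^sup>2 * x'^3) - c1\<^sup>2 / b\<^sup>2"
    using nz by (simp add: field_simps power2_eq_square power3_eq_cube)
  finally have K: "gauss_curvature ?Z ?p =
    - (k * (x'' * z' - x' * z'')) / (b\<^sup>2 * x'^3) - c1\<^sup>2 / b\<^sup>2" .

  have "mean_curvature ?Z ?p = 1 / 2 * ((x'\<^sup>2 * k - 2 * (a * x') * (c1 * x')
      + (a\<^sup>2 + b\<^sup>2) * (- (x'' * z' - x' * z'') / x')) / (b\<^sup>2 * x'\<^sup>2))"
    by (simp only: mean_curvature_def g h11 h12 h22 det)
  also have "\<dots> = (k - 2 * a * c1) / (2 * b\<^sup>2)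
      - (a\<^sup>2 + b\<^sup>2) / (2 * b\<^sup>2) * ((x'' * z' - x' * z'') / x'^3)"
    using nz by (simp add: field_simps power2_eq_square power3_eq_cube)
  also have "k - 2 * a * c1 = b * c2 - a * c1"
    by (simp add: k_def)
  finally have H: "mean_curvature ?Z ?p = (b * c2 - a * c1) / (2 * b\<^sup>2)
      - (a\<^sup>2 + b\<^sup>2) / (2 * b\<^sup>2) * ((x'' * z' - x' * z'') / x'^3)" .

  show "gauss_curvature ?Z ?p =
      - ((a * c1 + b * c2) *
          (deriv (deriv x) u * deriv z u - deriv x u * deriv (deriv z) u)) /
        (b\<^sup>2 * (deriv x u)^3)
      - c1\<^sup>2 / b\<^sup>2
    \<and>
    mean_curvature ?Z ?p =
      (b * c2 - a * c1) / (2 * b\<^sup>2)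
      - (a\<^sup>2 + b\<^sup>2) / (2 * b\<^sup>2) *
        ((deriv (deriv x) u * deriv z u - deriv x u * deriv (deriv z) u) / (deriv x u)^3)"
    using K H unfolding names by blast
qed

end
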